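(* Let $(R,\mathfrak{m})$ be a local domain, let $cl$ be an operation obeying the big axioms, and let $\alpha:R\to M$ be an injection of $R$-modules, with short exact sequence $0\to R\xrightarrow{\alpha}M\xrightarrow{\beta}Q\to0$. If $\tilde\nu\in(\mathrm{Im}\,\nu^\vee)^{cl}_{G^\vee}$ for some choice of free presentation $G\xrightarrow{\nu}F\xrightarrow{\mu}Q\to0$ of $Q$ and some choice of lift $\tilde\mu:F\to M$ of $\mu$, then the same is true for all free presentations of $Q$ and all choices of $\tilde\mu$.
   Context: A local ring is a commutative Noetherian local ring. Let $(R,\mathfrak{m})$ be a local domain; modules are arbitrary, not necessarily finitely generated. Write $(-)^\vee=\mathrm{Hom}_R(-,R)$. Given the injection $\alpha:R\to M$ and $0\to R\xrightarrow{\alpha}M\xrightarrow{\beta}Q\to 0$, a free presentation $G\xrightarrow{\nu}F\xrightarrow{\mu}Q\to 0$ ($F,G$ free, possibly of infinite rank) and a lift $\tilde\mu:F\to M$ with $\beta\circ\tilde\mu=\mu$, the map $\tilde\nu:G\to R$ is $\tilde\nu=\alpha^{-1}\circ\tilde\mu\circ\nu$ (well defined since $\tilde\mu\circ\nu$ maps into $\ker\beta=\mathrm{Im}\,\alpha$). The map $\nu^\vee:F^\vee\to G^\vee$ is $h\mapsto h\circ\nu$. Big axioms: an operation $cl$ assigning to each $R$-module $M$ and submodule $N\subseteq M$ a subset $N^{cl}_M\subseteq M$ obeys the big axioms if the following hold for arbitrary $R$-modules: (1) $N_M^{cl}$ is a submodule of $M$ containing $N$. (2) $(N_M^{cl})_M^{cl}=N_M^{cl}$.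 (3) If $N\subseteq M\subseteq W$, then $N_W^{cl}\subseteq M_W^{cl}$. (4) If $f:M\to W$ is a homomorphism and $N\subseteq M$, then $f(N_M^{cl})\subseteq f(N)_W^{cl}$. (5) If $N_M^{cl}=N$, then $0_{M/N}^{cl}=0$. (6) $\mathfrak{m}_R^{cl}=\mathfrak{m}$. (7) Let $x_1,\ldots,x_{k+1}$ be a partial system of parameters for $R$ ($k\ge 0$), and let $J=(x_1,\ldots,x_k)$ ($J=0$ if $k=0$). If there is a surjective homomorphism $f:M\to R/J$ and $v\in M$ with $f(v)=x_{k+1}+J$, then $(Rv)_M^{cl}\cap\ker f\subseteq (Jv)_M^{cl}$. *)

theory Defs
  imports
    "HOL-Algebra.Module"
    "HOL-Algebra.Ring_Divisibility"
    "HOL-Library.Extended_Nat"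
begin

section \<open>Local domains and systems of parameters\<close>

definition local_domain :: "('a, 'r) ring_scheme \<Rightarrow> 'a set \<Rightarrow> bool" where
  "local_domain R \<mm> \<longleftrightarrow> noetherian_domain R \<and> cring R \<and>
     maximalideal \<mm> R \<and> (\<forall>I. maximalideal I R \<longrightarrow> I = \<mm>)"

definition krull_dim :: "('a, 'r) ring_scheme \<Rightarrow> enat" where
  "krull_dim R = Sup {enat n | n. \<exists>P :: nat \<Rightarrow> 'a set.
     (\<forall>i\<le>n. primeideal (P i) R) \<and> (\<forall>i<n. P i \<subset> P (Suc i))}"

definition radical :: "('a, 'r) ring_scheme \<Rightarrow> 'a set \<Rightarrow> 'a set" where
  "radical R I = {a \<in> carrier R. \<exists>n::nat. a [^]\<^bsub>R\<^esub> n \<in> I}"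

definition system_of_parameters :: "('a, 'r) ring_scheme \<Rightarrow> 'a set \<Rightarrow> 'a list \<Rightarrow> bool" where
  "system_of_parameters R \<mm> xs \<longleftrightarrow> set xs \<subseteq> \<mm> \<and> enat (length xs) = krull_dim R \<and>
     radical R (Idl\<^bsub>R\<^esub> (set xs)) = \<mm>"

definition partial_system_of_parameters :: "('a, 'r) ring_scheme \<Rightarrow> 'a set \<Rightarrow> 'a list \<Rightarrow> bool" where
  "partial_system_of_parameters R \<mm> xs \<longleftrightarrow> (\<exists>ys. system_of_parameters R \<mm> (xs @ ys))"


section \<open>Homomorphisms, quotients, duals, free modules\<close>

text \<open>Module records extend ring records; the fields \<open>mult\<close> and \<open>one\<close> play no role
  in a module and are left undefined below where there is no canonical choice.\<close>

definition mod_hom ::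
  "('a, 'r) ring_scheme \<Rightarrow> ('a, 'm) module \<Rightarrow> ('a, 'n) module \<Rightarrow> ('m \<Rightarrow> 'n) set" where
  "mod_hom R M N = {f \<in> carrier M \<rightarrow> carrier N.
     (\<forall>x\<in>carrier M. \<forall>y\<in>carrier M. f (x \<oplus>\<^bsub>M\<^esub> y) = f x \<oplus>\<^bsub>N\<^esub> f y) \<and>
     (\<forall>a\<in>carrier R. \<forall>x\<in>carrier M. f (a \<odot>\<^bsub>M\<^esub> x) = a \<odot>\<^bsub>N\<^esub> f x)}"

definition mod_iso ::
  "('a, 'r) ring_scheme \<Rightarrow> ('a, 'm) module \<Rightarrow> ('a, 'n) module \<Rightarrow> ('m \<Rightarrow> 'n) set" where
  "mod_iso R M N = {f \<in> mod_hom R M N. bij_betw f (carrier M) (carrier N)}"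

definition regular_module :: "('a, 'r) ring_scheme \<Rightarrow> ('a, 'a) module" where
  "regular_module R = \<lparr>carrier = carrier R, monoid.mult = monoid.mult R, one = one R,
     zero = zero R, add = add R, smult = monoid.mult R\<rparr>"

definition quotient_module ::
  "('a, 'r) ring_scheme \<Rightarrow> ('a, 'm) module \<Rightarrow> 'm set \<Rightarrow> ('a, 'm set) module" where
  "quotient_module R M N = \<lparr>carrier = a_rcosets\<^bsub>M\<^esub> N, monoid.mult = undefined, one = undefined,
     zero = N, add = set_add M,
     smult = (\<lambda>a X. \<Union>x\<in>X. N +>\<^bsub>M\<^esub> (a \<odot>\<^bsub>M\<^esub> x))\<rparr>"

text \<open>The dual \<open>Hom\<^sub>R(M, R)\<close>. Homomorphisms are made extensional (undefined outside the
  carrier), so that equality in the dual is equality of maps on \<open>M\<close>.\<close>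

definition dual_module ::
  "('a, 'r) ring_scheme \<Rightarrow> ('a, 'm) module \<Rightarrow> ('a, 'm \<Rightarrow> 'a) module" where
  "dual_module R M = \<lparr>carrier = mod_hom R M (regular_module R) \<inter> extensional (carrier M),
     monoid.mult = undefined, one = undefined,
     zero = (\<lambda>x\<in>carrier M. \<zero>\<^bsub>R\<^esub>),
     add = (\<lambda>f g. \<lambda>x\<in>carrier M. f x \<oplus>\<^bsub>R\<^esub> g x),
     smult = (\<lambda>a f. \<lambda>x\<in>carrier M. a \<otimes>\<^bsub>R\<^esub> f x)\<rparr>"

definition dual_map :: "('a, 'm) module \<Rightarrow> ('m \<Rightarrow> 'n) \<Rightarrow> ('n \<Rightarrow> 'a) \<Rightarrow> ('m \<Rightarrow> 'a)" where
  "dual_map M f h = compose (carrier M) h f"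

definition module_basis :: "('a, 'r) ring_scheme \<Rightarrow> ('a, 'm) module \<Rightarrow> 'm set \<Rightarrow> bool" where
  "module_basis R M B \<longleftrightarrow> B \<subseteq> carrier M \<and>
     (\<forall>x\<in>carrier M. \<exists>!c. c \<in> B \<rightarrow>\<^sub>E carrier R \<and> finite {b \<in> B. c b \<noteq> \<zero>\<^bsub>R\<^esub>} \<and>
        x = (\<Oplus>\<^bsub>M\<^esub> b \<in> {b \<in> B. c b \<noteq> \<zero>\<^bsub>R\<^esub>}. c b \<odot>\<^bsub>M\<^esub> b))"

definition free_module :: "('a, 'r) ring_scheme \<Rightarrow> ('a, 'm) module \<Rightarrow> bool" where
  "free_module R M \<longleftrightarrow> module R M \<and> (\<exists>B. module_basis R M B)"

definition short_exact ::
  "('a, 'r) ring_scheme \<Rightarrow> ('a, 'l) module \<Rightarrow> ('l \<Rightarrow> 'm) \<Rightarrow> ('a, 'm) module \<Rightarrow>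
   ('m \<Rightarrow> 'q) \<Rightarrow> ('a, 'q) module \<Rightarrow> bool" where
  "short_exact R L \<alpha> M \<beta> Q \<longleftrightarrow> module R L \<and> module R M \<and> module R Q \<and>
     \<alpha> \<in> mod_hom R L M \<and> \<beta> \<in> mod_hom R M Q \<and>
     inj_on \<alpha> (carrier L) \<and> \<alpha> ` carrier L = a_kernel M Q \<beta> \<and> \<beta> ` carrier M = carrier Q"

definition free_presentation ::
  "('a, 'r) ring_scheme \<Rightarrow> ('a, 'g) module \<Rightarrow> ('g \<Rightarrow> 'f) \<Rightarrow> ('a, 'f) module \<Rightarrow>
   ('f \<Rightarrow> 'q) \<Rightarrow> ('a, 'q) module \<Rightarrow> bool" where
  "free_presentation R G \<nu> F \<mu> Q \<longleftrightarrow> free_module R G \<and> free_module R F \<and> module R Q \<and>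
     \<nu> \<in> mod_hom R G F \<and> \<mu> \<in> mod_hom R F Q \<and>
     \<nu> ` carrier G = a_kernel F Q \<mu> \<and> \<mu> ` carrier F = carrier Q"

definition lift_along ::
  "('a, 'r) ring_scheme \<Rightarrow> ('a, 'f) module \<Rightarrow> ('f \<Rightarrow> 'q) \<Rightarrow> ('a, 'm) module \<Rightarrow>
   ('m \<Rightarrow> 'q) \<Rightarrow> ('f \<Rightarrow> 'm) \<Rightarrow> bool" where
  "lift_along R F \<mu> M \<beta> \<mu>' \<longleftrightarrow> \<mu>' \<in> mod_hom R F M \<and> (\<forall>x\<in>carrier F. \<beta> (\<mu>' x) = \<mu> x)"

text \<open>The map \<open>\<alpha>\<inverse> \<circ> \<mu>' \<circ> \<nu> : G \<rightarrow> R\<close>, as an element of the dual of \<open>G\<close>.\<close>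

definition nu_tilde ::
  "('a, 'r) ring_scheme \<Rightarrow> ('a \<Rightarrow> 'm) \<Rightarrow> ('f \<Rightarrow> 'm) \<Rightarrow> ('a, 'g) module \<Rightarrow> ('g \<Rightarrow> 'f) \<Rightarrow> ('g \<Rightarrow> 'a)" where
  "nu_tilde R \<alpha> \<mu>' G \<nu> = (\<lambda>x\<in>carrier G. inv_into (carrier R) \<alpha> (\<mu>' (\<nu> x)))"


section \<open>The big axioms\<close>

text \<open>The operation acts on all modules whose carrier is a subset of the type \<open>'u\<close>, which plays
  the role of the universe of modules. The modules \<open>M/N\<close> and \<open>R\<close>, to which the closure is applied
  in \<open>big_quotient\<close> and \<open>big_maximal\<close>, have carriers in other types; there the condition is
  stated for the isomorphic copies \<open>P\<close> of them in \<open>'u\<close>. With \<open>'u = 'g \<Rightarrow> 'a\<close> the universe contains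
  the duals of all modules with carrier in \<open>'g\<close>, copies of all quotients of its members, and a copy
  of \<open>R\<close> (the constant functions).\<close>

locale big_axioms =
  fixes R :: "('a, 'r) ring_scheme"
    and \<mm> :: "'a set"
    and cl :: "('a, 'u) module \<Rightarrow> 'u set \<Rightarrow> 'u set"
  assumes big_extensive:
      "\<And>M N. \<lbrakk>module R M; submodule N R M\<rbrakk> \<Longrightarrow> submodule (cl M N) R M \<and> N \<subseteq> cl M N"
    and big_idempotent:
      "\<And>M N. \<lbrakk>module R M; submodule N R M\<rbrakk> \<Longrightarrow> cl M (cl M N) = cl M N"
    and big_mono:
      "\<And>W M' N. \<lbrakk>module R W; submodule M' R W; submodule N R W; N \<subseteq> M'\<rbrakk> \<Longrightarrow> cl W N \<subseteq> cl W M'"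
    and big_functorial:
      "\<And>M W N f. \<lbrakk>module R M; module R W; f \<in> mod_hom R M W; submodule N R M\<rbrakk>
        \<Longrightarrow> f ` cl M N \<subseteq> cl W (f ` N)"
    and big_quotient:
      "\<And>M N P i. \<lbrakk>module R M; submodule N R M; cl M N = N;
        module R P; i \<in> mod_iso R (quotient_module R M N) P\<rbrakk>
        \<Longrightarrow> cl P {\<zero>\<^bsub>P\<^esub>} = {\<zero>\<^bsub>P\<^esub>}"
    and big_maximal:
      "\<And>P i. \<lbrakk>module R P; i \<in> mod_iso R (regular_module R) P\<rbrakk> \<Longrightarrow> cl P (i ` \<mm>) = i ` \<mm>"
    and big_parameters:
      "\<And>xs x J M f v. \<lbrakk>partial_system_of_parameters R \<mm> (xs @ [x]); J = Idl\<^bsub>R\<^esub> (set xs); module R M;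
        f \<in> mod_hom R M (quotient_module R (regular_module R) J);
        f ` carrier M = carrier (quotient_module R (regular_module R) J);
        v \<in> carrier M; f v = J +>\<^bsub>R\<^esub> x\<rbrakk>
        \<Longrightarrow> cl M {a \<odot>\<^bsub>M\<^esub> v | a. a \<in> carrier R} \<inter>
              a_kernel M (quotient_module R (regular_module R) J) f
            \<subseteq> cl M {a \<odot>\<^bsub>M\<^esub> v | a. a \<in> J}"

end

theory Submission
  imports Defs
begin

text \<open>
  Write \<open>\<mu>t\<close>, \<open>\<mu>t'\<close> for the lifts and \<open>\<nu>t\<close>, \<open>\<nu>t'\<close> for the induced elements of \<open>G\<^sup>\<or>\<close>, \<open>G'\<^sup>\<or>\<close>.
  A comparison map from the second presentation to the first carries \<open>\<nu>t\<close> to \<open>\<nu>t'\<close> up to an element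
  of \<open>Im \<nu>'\<^sup>\<or>\<close>, and closures respect homomorphisms.

  In detail: free modules are projective (\<open>free_module_lifting\<close>), so the identity of \<open>Q\<close> extends to
  maps \<open>\<phi> : F' \<rightarrow> F\<close> and \<open>\<psi> : G' \<rightarrow> G\<close> with \<open>\<mu> \<circ> \<phi> = \<mu>'\<close> and \<open>\<nu> \<circ> \<psi> = \<phi> \<circ> \<nu>'\<close>
  (\<open>presentation_comparison\<close>). From \<open>h \<circ> \<nu> \<circ> \<psi> = h \<circ> \<phi> \<circ> \<nu>'\<close> the dual map \<open>\<psi>\<^sup>\<or> : G\<^sup>\<or> \<rightarrow> G'\<^sup>\<or>\<close> sends
  \<open>Im \<nu>\<^sup>\<or>\<close> into \<open>Im \<nu>'\<^sup>\<or>\<close> (\<open>dual_map_image_subset\<close>). By functoriality and monotonicity of the closure,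
  \<open>\<psi>\<^sup>\<or>(\<nu>t)\<close> lies in the closure of \<open>Im \<nu>'\<^sup>\<or>\<close>.

  It remains to compare \<open>\<psi>\<^sup>\<or>(\<nu>t) = \<alpha>\<inverse> \<circ> \<mu>t \<circ> \<phi> \<circ> \<nu>'\<close> with \<open>\<nu>t' = \<alpha>\<inverse> \<circ> \<mu>t' \<circ> \<nu>'\<close>. Both \<open>\<mu>t \<circ> \<phi>\<close> and
  \<open>\<mu>t'\<close> are lifts of \<open>\<mu>'\<close>, so their difference maps into \<open>Im \<alpha>\<close> and has the form \<open>\<alpha> \<circ> h\<close> with
  \<open>h \<in> F'\<^sup>\<or>\<close>. Hence \<open>\<nu>t' = \<psi>\<^sup>\<or>(\<nu>t) + \<nu>'\<^sup>\<or>(h)\<close> (\<open>nu_tilde_comparison\<close>), and both summands lie in the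
  closure of \<open>Im \<nu>'\<^sup>\<or>\<close>, which is a submodule containing \<open>Im \<nu>'\<^sup>\<or>\<close>.
\<close>

section \<open>Module homomorphisms\<close>

lemma mod_homI:
  assumes "\<And>x. x \<in> carrier M \<Longrightarrow> f x \<in> carrier N"
    and "\<And>x y. \<lbrakk>x \<in> carrier M; y \<in> carrier M\<rbrakk> \<Longrightarrow> f (x \<oplus>\<^bsub>M\<^esub> y) = f x \<oplus>\<^bsub>N\<^esub> f y"
    and "\<And>a x. \<lbrakk>a \<in> carrier R; x \<in> carrier M\<rbrakk> \<Longrightarrow> f (a \<odot>\<^bsub>M\<^esub> x) = a \<odot>\<^bsub>N\<^esub> f x"
  shows "f \<in> mod_hom R M N"
  using assms by (auto simp: mod_hom_def)

lemma
  assumes "f \<in> mod_hom R M N"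
  shows mod_hom_closed: "x \<in> carrier M \<Longrightarrow> f x \<in> carrier N"
    and mod_hom_add: "\<lbrakk>x \<in> carrier M; y \<in> carrier M\<rbrakk> \<Longrightarrow> f (x \<oplus>\<^bsub>M\<^esub> y) = f x \<oplus>\<^bsub>N\<^esub> f y"
    and mod_hom_smult: "\<lbrakk>a \<in> carrier R; x \<in> carrier M\<rbrakk> \<Longrightarrow> f (a \<odot>\<^bsub>M\<^esub> x) = a \<odot>\<^bsub>N\<^esub> f x"
  using assms by (auto simp: mod_hom_def)

lemma mod_hom_compose:
  assumes "f \<in> mod_hom R L M" "g \<in> mod_hom R M N"
  shows "(\<lambda>x. g (f x)) \<in> mod_hom R L N"
  using assms by (auto simp: mod_hom_def Pi_iff)

lemma mod_hom_diff:
  assumes "module R M" "module R N" "f \<in> mod_hom R M N" "g \<in> mod_hom R M N"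
  shows "(\<lambda>x. f x \<ominus>\<^bsub>N\<^esub> g x) \<in> mod_hom R M N"
proof -
  interpret M: module R M by fact
  interpret N: module R N by fact
  note f = mod_hom_closed[OF assms(3)] mod_hom_add[OF assms(3)] mod_hom_smult[OF assms(3)]
  note g = mod_hom_closed[OF assms(4)] mod_hom_add[OF assms(4)] mod_hom_smult[OF assms(4)]
  show ?thesis
    by (rule mod_homI)
      (simp_all add: f g N.minus_eq N.minus_add N.a_ac N.smult_r_distr N.smult_r_minus)
qed

lemma mod_hom_abelian_group_hom:
  assumes "module R M" "module R N" "f \<in> mod_hom R M N"
  shows "abelian_group_hom M N f"
proof -
  interpret M: module R M by fact
  interpret N: module R N by fact
  show ?thesis
    using assms(3)
    by (intro abelian_group_homI group_hom.intro M.abelian_group_axioms N.abelian_group_axioms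
         M.a_group N.a_group group_hom_axioms.intro) (auto simp: mod_hom_def hom_def)
qed

lemma mod_hom_finsum:
  assumes "module R M" "module R N" "f \<in> mod_hom R M N" "s \<in> A \<rightarrow> carrier M"
  shows "f (finsum M s A) = finsum N (\<lambda>i. f (s i)) A"
proof -
  interpret M: module R M by fact
  interpret N: module R N by fact
  interpret f: abelian_group_hom M N f by (rule mod_hom_abelian_group_hom; fact)
  show ?thesis
    using assms(4)
  proof (induction A rule: infinite_finite_induct)
    case (infinite A)
    then show ?case by (simp add: M.finsum_infinite N.finsum_infinite)
  next
    case (insert i A)
    then have "(\<lambda>i. f (s i)) \<in> A \<rightarrow> carrier N" "f (s i) \<in> carrier N"
      by (auto intro!: f.hom_closed)
    with insert show ?case by simp
  qed simp
qed

lemma mod_hom_image_submodule: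
  assumes "module R M" "module R N" "f \<in> mod_hom R M N"
  shows "submodule (f ` carrier M) R N"
proof -
  interpret M: module R M by fact
  interpret N: module R N by fact
  interpret f: abelian_group_hom M N f by (rule mod_hom_abelian_group_hom; fact)
  show ?thesis
  proof (rule N.submoduleI)
    show "\<zero>\<^bsub>N\<^esub> \<in> f ` carrier M"
      by (metis M.zero_closed f.hom_zero imageI)
    show "\<ominus>\<^bsub>N\<^esub> y \<in> f ` carrier M" if "y \<in> f ` carrier M" for y
      using that by (metis (no_types, lifting) M.a_inv_closed f.hom_a_inv imageE imageI)
  next
    fix a b assume "a \<in> f ` carrier M" "b \<in> f ` carrier M"
    then show "a \<oplus>\<^bsub>N\<^esub> b \<in> f ` carrier M"
      by (auto simp flip: mod_hom_add[OF assms(3)])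
  next
    fix a y assume "a \<in> carrier R" "y \<in> f ` carrier M"
    then show "a \<odot>\<^bsub>N\<^esub> y \<in> f ` carrier M"
      by (auto simp flip: mod_hom_smult[OF assms(3)])
  qed auto
qed

section \<open>Free modules are projective\<close>

text \<open>The family \<open>s\<close> of vectors is kept apart from the index set \<open>B\<close>: coordinates with respect to a
  basis \<open>B\<close> of one module are reused with the images of \<open>B\<close> in another.\<close>

definition lin_comb ::
  "('a, 'r) ring_scheme \<Rightarrow> ('a, 'm, 'n) module_scheme \<Rightarrow> 'b set \<Rightarrow> ('b \<Rightarrow> 'a) \<Rightarrow> ('b \<Rightarrow> 'm) \<Rightarrow> 'm" where
  "lin_comb R M B c s = (\<Oplus>\<^bsub>M\<^esub> b \<in> {b \<in> B. c b \<noteq> \<zero>\<^bsub>R\<^esub>}. c b \<odot>\<^bsub>M\<^esub> s b)"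

text \<open>The coordinate vectors of the free module on \<open>B\<close>, made extensional so that a basis gives
  unique coordinates.\<close>

definition fin_coeffs :: "('a, 'r) ring_scheme \<Rightarrow> 'b set \<Rightarrow> ('b \<Rightarrow> 'a) set" where
  "fin_coeffs R B = {c \<in> B \<rightarrow>\<^sub>E carrier R. finite {b \<in> B. c b \<noteq> \<zero>\<^bsub>R\<^esub>}}"

context module
begin

lemma lin_comb_closed:
  assumes "c \<in> fin_coeffs R B" "s \<in> B \<rightarrow> carrier M"
  shows "lin_comb R M B c s \<in> carrier M"
  using assms by (auto simp: lin_comb_def fin_coeffs_def intro!: M.finsum_closed)

lemma lin_comb_eq_finsum:
  assumes "c \<in> fin_coeffs R B" "s \<in> B \<rightarrow> carrier M"
    and "finite A" "A \<subseteq> B" "{b \<in> B. c b \<noteq> \<zero>} \<subseteq> A"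
  shows "lin_comb R M B c s = (\<Oplus>\<^bsub>M\<^esub> b \<in> A. c b \<odot>\<^bsub>M\<^esub> s b)"
  unfolding lin_comb_def
proof (rule M.add.finprod_mono_neutral_cong_left)
  show "c b \<odot>\<^bsub>M\<^esub> s b = \<zero>\<^bsub>M\<^esub>" if "b \<in> A - {b \<in> B. c b \<noteq> \<zero>}" for b
  proof -
    have "c b = \<zero>" "s b \<in> carrier M"
      using that assms by auto
    then show ?thesis by simp
  qed
  show "(\<lambda>b. c b \<odot>\<^bsub>M\<^esub> s b) \<in> A \<rightarrow> carrier M"
    using assms by (auto simp: fin_coeffs_def intro!: smult_closed)
qed (use assms in auto)

lemma fin_coeffs_add:
  assumes "c \<in> fin_coeffs R B" "d \<in> fin_coeffs R B"
  shows "(\<lambda>b\<in>B. c b \<oplus> d b) \<in> fin_coeffs R B"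
proof -
  have "{b \<in> B. (\<lambda>b\<in>B. c b \<oplus> d b) b \<noteq> \<zero>} \<subseteq> {b \<in> B. c b \<noteq> \<zero>} \<union> {b \<in> B. d b \<noteq> \<zero>}"
    by auto
  moreover have "finite ({b \<in> B. c b \<noteq> \<zero>} \<union> {b \<in> B. d b \<noteq> \<zero>})"
    using assms by (simp add: fin_coeffs_def)
  ultimately have "finite {b \<in> B. (\<lambda>b\<in>B. c b \<oplus> d b) b \<noteq> \<zero>}"
    by (rule finite_subset)
  with assms show ?thesis
    unfolding fin_coeffs_def by (simp add: PiE_iff)
qed

lemma fin_coeffs_smult:
  assumes "a \<in> carrier R" "c \<in> fin_coeffs R B"
  shows "(\<lambda>b\<in>B. a \<otimes> c b) \<in> fin_coeffs R B"
proof -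
  have "{b \<in> B. (\<lambda>b\<in>B. a \<otimes> c b) b \<noteq> \<zero>} \<subseteq> {b \<in> B. c b \<noteq> \<zero>}"
    using assms by auto
  moreover have "finite {b \<in> B. c b \<noteq> \<zero>}"
    using assms by (simp add: fin_coeffs_def)
  ultimately have "finite {b \<in> B. (\<lambda>b\<in>B. a \<otimes> c b) b \<noteq> \<zero>}"
    by (rule finite_subset)
  with assms show ?thesis
    unfolding fin_coeffs_def by (simp add: PiE_iff)
qed

lemma lin_comb_add:
  assumes c: "c \<in> fin_coeffs R B" and d: "d \<in> fin_coeffs R B" and s: "s \<in> B \<rightarrow> carrier M"
  shows "lin_comb R M B (\<lambda>b\<in>B. c b \<oplus> d b) s = lin_comb R M B c s \<oplus>\<^bsub>M\<^esub> lin_comb R M B d s"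
proof -
  \<comment> \<open>The three supports differ, so all three sums are taken over one finite set.\<close>
  let ?A = "{b \<in> B. c b \<noteq> \<zero>} \<union> {b \<in> B. d b \<noteq> \<zero>}"
  have A: "finite ?A" "?A \<subseteq> B"
    using c d by (auto simp: fin_coeffs_def)
  have "lin_comb R M B (\<lambda>b\<in>B. c b \<oplus> d b) s = (\<Oplus>\<^bsub>M\<^esub> b \<in> ?A. (\<lambda>b\<in>B. c b \<oplus> d b) b \<odot>\<^bsub>M\<^esub> s b)"
    using A by (intro lin_comb_eq_finsum fin_coeffs_add c d s) auto
  also have "\<dots> = (\<Oplus>\<^bsub>M\<^esub> b \<in> ?A. c b \<odot>\<^bsub>M\<^esub> s b \<oplus>\<^bsub>M\<^esub> d b \<odot>\<^bsub>M\<^esub> s b)"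
    using c d s by (intro M.finsum_cong') (auto simp: fin_coeffs_def smult_l_distr Pi_iff PiE_iff)
  also have "\<dots> = (\<Oplus>\<^bsub>M\<^esub> b \<in> ?A. c b \<odot>\<^bsub>M\<^esub> s b) \<oplus>\<^bsub>M\<^esub> (\<Oplus>\<^bsub>M\<^esub> b \<in> ?A. d b \<odot>\<^bsub>M\<^esub> s b)"
    using c d s by (intro M.finsum_addf) (auto simp: fin_coeffs_def Pi_iff PiE_iff)
  also have "(\<Oplus>\<^bsub>M\<^esub> b \<in> ?A. c b \<odot>\<^bsub>M\<^esub> s b) = lin_comb R M B c s"
    using A by (intro lin_comb_eq_finsum[symmetric] c s) auto
  also have "(\<Oplus>\<^bsub>M\<^esub> b \<in> ?A. d b \<odot>\<^bsub>M\<^esub> s b) = lin_comb R M B d s"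
    using A by (intro lin_comb_eq_finsum[symmetric] d s) auto
  finally show ?thesis .
qed

lemma lin_comb_smult:
  assumes a: "a \<in> carrier R" and c: "c \<in> fin_coeffs R B" and s: "s \<in> B \<rightarrow> carrier M"
  shows "lin_comb R M B (\<lambda>b\<in>B. a \<otimes> c b) s = a \<odot>\<^bsub>M\<^esub> lin_comb R M B c s"
proof -
  let ?A = "{b \<in> B. c b \<noteq> \<zero>}"
  have A: "finite ?A"
    using c by (auto simp: fin_coeffs_def)
  have "lin_comb R M B (\<lambda>b\<in>B. a \<otimes> c b) s = (\<Oplus>\<^bsub>M\<^esub> b \<in> ?A. (\<lambda>b\<in>B. a \<otimes> c b) b \<odot>\<^bsub>M\<^esub> s b)"
    using A a by (intro lin_comb_eq_finsum fin_coeffs_smult c s) auto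
  also have "\<dots> = (\<Oplus>\<^bsub>M\<^esub> b \<in> ?A. a \<odot>\<^bsub>M\<^esub> (c b \<odot>\<^bsub>M\<^esub> s b))"
    using a c s by (intro M.finsum_cong') (auto simp: fin_coeffs_def smult_assoc1 Pi_iff PiE_iff)
  also have "\<dots> = a \<odot>\<^bsub>M\<^esub> lin_comb R M B c s"
    unfolding lin_comb_def
    using A a c s by (intro finsum_smult_ldistr[symmetric]) (auto simp: fin_coeffs_def)
  finally show ?thesis .
qed

end

lemma mod_hom_lin_comb:
  assumes "module R M" "module R N" "f \<in> mod_hom R M N"
    and "c \<in> fin_coeffs R B" "s \<in> B \<rightarrow> carrier M"
  shows "f (lin_comb R M B c s) = lin_comb R N B c (\<lambda>b. f (s b))"
proof -
  interpret M: module R M by fact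
  interpret N: module R N by fact
  have "f (lin_comb R M B c s) = (\<Oplus>\<^bsub>N\<^esub> b \<in> {b \<in> B. c b \<noteq> \<zero>\<^bsub>R\<^esub>}. f (c b \<odot>\<^bsub>M\<^esub> s b))"
    unfolding lin_comb_def
    using assms(4,5) by (intro mod_hom_finsum[OF assms(1-3)]) (auto simp: fin_coeffs_def)
  also have "\<dots> = lin_comb R N B c (\<lambda>b. f (s b))"
    unfolding lin_comb_def
    using assms(4,5)
    by (intro N.finsum_cong')
      (auto simp: fin_coeffs_def Pi_iff PiE_iff mod_hom_smult[OF assms(3)] mod_hom_closed[OF assms(3)])
  finally show ?thesis .
qed

text \<open>Choose a preimage \<open>s b\<close> under \<open>g\<close> of \<open>f b\<close> for each basis vector \<open>b\<close> and extend linearly. The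
  condition compares the images of \<open>f\<close> and \<open>g\<close> so that the lemma covers both degrees of a
  presentation: lifting along the surjection \<open>\<mu>\<close>, and along \<open>\<nu>\<close>, whose image is only a kernel.\<close>

lemma free_module_lifting:
  assumes F: "free_module R F" and M: "module R M" and Q: "module R Q"
    and g: "g \<in> mod_hom R M Q" and f: "f \<in> mod_hom R F Q"
    and sub: "f ` carrier F \<subseteq> g ` carrier M"
  obtains h where "h \<in> mod_hom R F M" "\<And>x. x \<in> carrier F \<Longrightarrow> g (h x) = f x"
proof -
  obtain B where modF: "module R F" and "module_basis R F B"
    using F by (auto simp: free_module_def)
  then have B: "B \<subseteq> carrier F"
    and basis: "\<And>x. x \<in> carrier F \<Longrightarrow> \<exists>!c. c \<in> fin_coeffs R B \<and> x = lin_comb R F B c (\<lambda>b. b)"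
    by (auto simp: module_basis_def fin_coeffs_def lin_comb_def)
  interpret F: module R F by fact
  interpret M: module R M by fact
  interpret Q: module R Q by fact
  define co where "co x = (THE c. c \<in> fin_coeffs R B \<and> x = lin_comb R F B c (\<lambda>b. b))" for x
  have co: "co x \<in> fin_coeffs R B" "lin_comb R F B (co x) (\<lambda>b. b) = x" if "x \<in> carrier F" for x
    using theI'[OF basis[OF that]] unfolding co_def by auto
  have co_eq: "co x = c"
    if "x \<in> carrier F" "c \<in> fin_coeffs R B" "x = lin_comb R F B c (\<lambda>b. b)" for x c
    using basis[OF that(1)] co[OF that(1)] that(2,3) by metis
  have idB: "(\<lambda>b. b) \<in> B \<rightarrow> carrier F"
    using B by auto
  \<comment> \<open>Coordinates are linear because they are unique.\<close>
  have co_add: "co (x \<oplus>\<^bsub>F\<^esub> y) = (\<lambda>b\<in>B. co x b \<oplus>\<^bsub>R\<^esub> co y b)"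
    if "x \<in> carrier F" "y \<in> carrier F" for x y
    using that by (intro co_eq) (auto simp: F.fin_coeffs_add F.lin_comb_add co idB)
  have co_smult: "co (a \<odot>\<^bsub>F\<^esub> x) = (\<lambda>b\<in>B. a \<otimes>\<^bsub>R\<^esub> co x b)"
    if "a \<in> carrier R" "x \<in> carrier F" for a x
    using that by (intro co_eq) (auto simp: F.fin_coeffs_smult F.lin_comb_smult co idB)
  have "\<forall>b\<in>B. \<exists>m\<in>carrier M. g m = f b"
    using sub B by force
  then obtain s where s: "s \<in> B \<rightarrow> carrier M" and gs: "\<And>b. b \<in> B \<Longrightarrow> g (s b) = f b"
    by (metis Pi_I)
  define h where "h x = lin_comb R M B (co x) s" for x
  show thesis
  proof (rule that)
    show "h \<in> mod_hom R F M"
      by (rule mod_homI)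
        (simp_all add: h_def M.lin_comb_closed M.lin_comb_add M.lin_comb_smult co co_add co_smult s)
    show "g (h x) = f x" if x: "x \<in> carrier F" for x
    proof -
      have "g (h x) = lin_comb R Q B (co x) (\<lambda>b. g (s b))"
        unfolding h_def by (rule mod_hom_lin_comb[OF M Q g co(1)[OF x] s])
      also have "\<dots> = lin_comb R Q B (co x) (\<lambda>b. f b)"
        unfolding lin_comb_def using co(1)[OF x] B f
        by (intro Q.finsum_cong') (auto simp: gs fin_coeffs_def intro!: mod_hom_closed[OF f])
      also have "\<dots> = f x"
        using mod_hom_lin_comb[OF modF Q f co(1)[OF x] idB] co(2)[OF x] by simp
      finally show ?thesis .
    qed
  qed
qed

section \<open>Dual modules\<close>

lemma regular_module_simps:
  "carrier (regular_module R) = carrier R"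
  "a \<oplus>\<^bsub>regular_module R\<^esub> b = a \<oplus>\<^bsub>R\<^esub> b"
  "a \<odot>\<^bsub>regular_module R\<^esub> b = a \<otimes>\<^bsub>R\<^esub> b"
  by (simp_all add: regular_module_def)

lemma dual_module_simps:
  "carrier (dual_module R M) = mod_hom R M (regular_module R) \<inter> extensional (carrier M)"
  "\<zero>\<^bsub>dual_module R M\<^esub> = (\<lambda>x\<in>carrier M. \<zero>\<^bsub>R\<^esub>)"
  "f \<oplus>\<^bsub>dual_module R M\<^esub> g = (\<lambda>x\<in>carrier M. f x \<oplus>\<^bsub>R\<^esub> g x)"
  "a \<odot>\<^bsub>dual_module R M\<^esub> f = (\<lambda>x\<in>carrier M. a \<otimes>\<^bsub>R\<^esub> f x)"
  by (simp_all add: dual_module_def)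

lemma
  assumes "f \<in> carrier (dual_module R M)"
  shows dual_closed: "x \<in> carrier M \<Longrightarrow> f x \<in> carrier R"
    and dual_add: "\<lbrakk>x \<in> carrier M; y \<in> carrier M\<rbrakk> \<Longrightarrow> f (x \<oplus>\<^bsub>M\<^esub> y) = f x \<oplus>\<^bsub>R\<^esub> f y"
    and dual_smult: "\<lbrakk>a \<in> carrier R; x \<in> carrier M\<rbrakk> \<Longrightarrow> f (a \<odot>\<^bsub>M\<^esub> x) = a \<otimes>\<^bsub>R\<^esub> f x"
    and dual_extensional: "f \<in> extensional (carrier M)"
  using assms by (auto simp: dual_module_simps mod_hom_def regular_module_simps)

lemma dualI:
  assumes "\<And>x. x \<in> carrier M \<Longrightarrow> f x \<in> carrier R"
    and "\<And>x y. \<lbrakk>x \<in> carrier M; y \<in> carrier M\<rbrakk> \<Longrightarrow> f (x \<oplus>\<^bsub>M\<^esub> y) = f x \<oplus>\<^bsub>R\<^esub> f y"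
    and "\<And>a x. \<lbrakk>a \<in> carrier R; x \<in> carrier M\<rbrakk> \<Longrightarrow> f (a \<odot>\<^bsub>M\<^esub> x) = a \<otimes>\<^bsub>R\<^esub> f x"
    and "f \<in> extensional (carrier M)"
  shows "f \<in> carrier (dual_module R M)"
  using assms by (auto simp: dual_module_simps mod_hom_def regular_module_simps)

lemma dual_module_is_module:
  assumes "module R M"
  shows "module R (dual_module R M)"
proof -
  interpret M: module R M by fact
  note ext = extensionalityI[where A = "carrier M"]
  note dual = dual_closed dual_add dual_smult
  have add: "(\<lambda>x\<in>carrier M. f x \<oplus>\<^bsub>R\<^esub> g x) \<in> carrier (dual_module R M)"
    if "f \<in> carrier (dual_module R M)" "g \<in> carrier (dual_module R M)" for f g
    by (rule dualI) (use that in \<open>auto simp: dual M.R.a_ac M.R.r_distr\<close>)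
  have smult: "(\<lambda>x\<in>carrier M. a \<otimes>\<^bsub>R\<^esub> f x) \<in> carrier (dual_module R M)"
    if "a \<in> carrier R" "f \<in> carrier (dual_module R M)" for a f
    by (rule dualI) (use that in \<open>auto simp: dual M.R.m_ac M.R.r_distr\<close>)
  have zero: "(\<lambda>x\<in>carrier M. \<zero>\<^bsub>R\<^esub>) \<in> carrier (dual_module R M)"
    by (rule dualI) auto
  have "abelian_group (dual_module R M)"
  proof (rule abelian_groupI)
    fix f assume f: "f \<in> carrier (dual_module R M)"
    \<comment> \<open>The additive inverse of \<open>f\<close> is \<open>(-1) f\<close>.\<close>
    let ?g = "\<lambda>x\<in>carrier M. (\<ominus>\<^bsub>R\<^esub> \<one>\<^bsub>R\<^esub>) \<otimes>\<^bsub>R\<^esub> f x"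
    show "\<exists>g\<in>carrier (dual_module R M). g \<oplus>\<^bsub>dual_module R M\<^esub> f = \<zero>\<^bsub>dual_module R M\<^esub>"
    proof (rule bexI)
      show "?g \<in> carrier (dual_module R M)"
        using f by (intro smult) auto
      show "?g \<oplus>\<^bsub>dual_module R M\<^esub> f = \<zero>\<^bsub>dual_module R M\<^esub>"
        using f by (intro ext) (auto simp: dual_module_simps(2-) dual_closed M.R.l_minus M.R.l_neg)
    qed
    show "\<zero>\<^bsub>dual_module R M\<^esub> \<oplus>\<^bsub>dual_module R M\<^esub> f = f"
      using f by (intro ext) (auto simp: dual_module_simps(2-) dual_closed dual_extensional)
  qed (auto simp: dual_module_simps(2-) add zero dual_closed M.R.a_ac intro!: ext)
  then show ?thesis
    by (intro moduleI M.R.is_cring)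
      (auto simp: dual_module_simps(2-) smult dual_closed dual_extensional
        M.R.l_distr M.R.r_distr M.R.m_assoc intro!: ext)
qed

lemma dual_map_mod_hom:
  assumes M: "module R M" and f: "f \<in> mod_hom R M N"
  shows "dual_map M f \<in> mod_hom R (dual_module R N) (dual_module R M)"
proof -
  interpret M: module R M by fact
  note mod_hom = mod_hom_closed[OF f] mod_hom_add[OF f] mod_hom_smult[OF f]
  note dual = dual_closed dual_add dual_smult
  show ?thesis
    by (intro mod_homI dualI extensionalityI[where A = "carrier M"])
      (auto simp: dual_map_def compose_def dual_module_simps(2-) mod_hom dual)
qed

section \<open>Comparison of presentations\<close>

text \<open>The map \<open>\<alpha>\<close> is a kernel of \<open>\<beta>\<close>. This makes \<open>\<alpha>\<inverse> \<circ> \<mu>t \<circ> \<nu>\<close> a well-defined element of the dual of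
  \<open>G\<close>, and likewise turns the difference of two lifts of the same map \<open>X \<rightarrow> Q\<close> into an element of
  the dual of \<open>X\<close>.\<close>

lemma short_exact_factor:
  assumes se: "short_exact R (regular_module R) \<alpha> M \<beta> Q"
    and X: "module R X" and f: "f \<in> mod_hom R X M"
    and \<beta>f: "\<And>x. x \<in> carrier X \<Longrightarrow> \<beta> (f x) = \<zero>\<^bsub>Q\<^esub>"
  shows "(\<lambda>x\<in>carrier X. inv_into (carrier R) \<alpha> (f x)) \<in> carrier (dual_module R X)"
    and "\<And>x. x \<in> carrier X \<Longrightarrow> \<alpha> (inv_into (carrier R) \<alpha> (f x)) = f x"
proof -
  interpret X: module R X by fact
  interpret M: module R M using se by (simp add: short_exact_def)
  let ?i = "inv_into (carrier R) \<alpha>"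
  have hom: "\<alpha> \<in> mod_hom R (regular_module R) M" and inj: "inj_on \<alpha> (carrier R)"
    and im: "\<alpha> ` carrier R = a_kernel M Q \<beta>"
    using se by (auto simp: short_exact_def regular_module_simps)
  have in_im: "f x \<in> \<alpha> ` carrier R" if "x \<in> carrier X" for x
    unfolding im using that \<beta>f mod_hom_closed[OF f] by (auto simp: a_kernel_def')
  show \<alpha>i: "\<alpha> (?i (f x)) = f x" if "x \<in> carrier X" for x
    by (rule f_inv_into_f[OF in_im[OF that]])
  have i: "?i (f x) \<in> carrier R" if "x \<in> carrier X" for x
    by (rule inv_into_into[OF in_im[OF that]])
  have i_eq: "?i y = r" if "r \<in> carrier R" "\<alpha> r = y" for r y
    using that inj by auto
  note \<alpha> = mod_hom_add[OF hom, unfolded regular_module_simps]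
    mod_hom_smult[OF hom, unfolded regular_module_simps]
  show "(\<lambda>x\<in>carrier X. ?i (f x)) \<in> carrier (dual_module R X)"
  proof (rule dualI)
    fix x y assume "x \<in> carrier X" "y \<in> carrier X"
    then show "(\<lambda>x\<in>carrier X. ?i (f x)) (x \<oplus>\<^bsub>X\<^esub> y)
        = (\<lambda>x\<in>carrier X. ?i (f x)) x \<oplus>\<^bsub>R\<^esub> (\<lambda>x\<in>carrier X. ?i (f x)) y"
      by (simp add: i_eq i \<alpha> \<alpha>i mod_hom_add[OF f])
  next
    fix a x assume "a \<in> carrier R" "x \<in> carrier X"
    then show "(\<lambda>x\<in>carrier X. ?i (f x)) (a \<odot>\<^bsub>X\<^esub> x) = a \<otimes>\<^bsub>R\<^esub> (\<lambda>x\<in>carrier X. ?i (f x)) x"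
      by (simp add: i_eq i \<alpha> \<alpha>i mod_hom_smult[OF f])
  qed (auto simp: i)
qed

text \<open>The map \<open>\<phi>\<close> exists since \<open>F'\<close> is free and \<open>\<mu>\<close> is onto. Then \<open>\<mu> \<circ> \<phi> \<circ> \<nu>' = \<mu>' \<circ> \<nu>' = 0\<close>, so \<open>\<phi> \<circ> \<nu>'\<close>
  lands in \<open>ker \<mu> = Im \<nu>\<close> and lifts along \<open>\<nu>\<close> since \<open>G'\<close> is free.\<close>

lemma presentation_comparison:
  assumes "free_presentation R G \<nu> F \<mu> Q" "free_presentation R G' \<nu>' F' \<mu>' Q"
  obtains \<phi> \<psi> where "\<phi> \<in> mod_hom R F' F" "\<psi> \<in> mod_hom R G' G"
    "\<And>x. x \<in> carrier F' \<Longrightarrow> \<mu> (\<phi> x) = \<mu>' x"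
    "\<And>x. x \<in> carrier G' \<Longrightarrow> \<nu> (\<psi> x) = \<phi> (\<nu>' x)"
proof -
  have mods: "module R G" "module R F" "module R F'" "module R Q"
    and free: "free_module R G'" "free_module R F'"
    and homs: "\<nu> \<in> mod_hom R G F" "\<mu> \<in> mod_hom R F Q" "\<nu>' \<in> mod_hom R G' F'" "\<mu>' \<in> mod_hom R F' Q"
    and exact: "\<nu> ` carrier G = a_kernel F Q \<mu>" "\<mu> ` carrier F = carrier Q"
      "\<nu>' ` carrier G' = a_kernel F' Q \<mu>'"
    using assms by (auto simp: free_presentation_def free_module_def)
  have "\<mu>' ` carrier F' \<subseteq> \<mu> ` carrier F"
    using mod_hom_closed[OF homs(4)] exact(2) by auto
  then obtain \<phi> where \<phi>: "\<phi> \<in> mod_hom R F' F" and \<mu>\<phi>: "\<And>x. x \<in> carrier F' \<Longrightarrow> \<mu> (\<phi> x) = \<mu>' x"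
    using free_module_lifting[OF free(2) mods(2,4) homs(2,4)] by blast
  have "\<phi> (\<nu>' x) \<in> \<nu> ` carrier G" if "x \<in> carrier G'" for x
  proof -
    have "\<nu>' x \<in> a_kernel F' Q \<mu>'"
      using that exact(3) by blast
    then show ?thesis
      unfolding exact(1) by (auto simp: a_kernel_def' \<mu>\<phi> mod_hom_closed[OF \<phi>])
  qed
  then have "(\<lambda>x. \<phi> (\<nu>' x)) ` carrier G' \<subseteq> \<nu> ` carrier G"
    by blast
  then obtain \<psi>
    where \<psi>: "\<psi> \<in> mod_hom R G' G" and \<nu>\<psi>: "\<And>x. x \<in> carrier G' \<Longrightarrow> \<nu> (\<psi> x) = \<phi> (\<nu>' x)"
    using free_module_lifting[OF free(1) mods(1,2) homs(1) mod_hom_compose[OF homs(3) \<phi>]] by blast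
  from \<phi> \<psi> \<mu>\<phi> \<nu>\<psi> show thesis
    by (rule that)
qed

text \<open>This is where the choice of the lifts enters: the correction term \<open>h\<close> is the difference of the
  lifts \<open>\<mu>t'\<close> and \<open>\<mu>t \<circ> \<phi>\<close> of \<open>\<mu>'\<close>, read through \<open>\<alpha>\<close>. The identity is checked after applying the
  injection \<open>\<alpha>\<close>, where it becomes \<open>\<mu>t' \<circ> \<nu>' = \<mu>t \<circ> \<phi> \<circ> \<nu>' + (\<mu>t' - \<mu>t \<circ> \<phi>) \<circ> \<nu>'\<close>.\<close>

lemma nu_tilde_comparison:
  assumes se: "short_exact R (regular_module R) \<alpha> M \<beta> Q"
    and pres: "free_presentation R G \<nu> F \<mu> Q" "free_presentation R G' \<nu>' F' \<mu>' Q"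
    and lift: "lift_along R F \<mu> M \<beta> \<mu>t" "lift_along R F' \<mu>' M \<beta> \<mu>t'"
    and \<phi>: "\<phi> \<in> mod_hom R F' F" "\<And>x. x \<in> carrier F' \<Longrightarrow> \<mu> (\<phi> x) = \<mu>' x"
    and \<psi>: "\<psi> \<in> mod_hom R G' G" "\<And>x. x \<in> carrier G' \<Longrightarrow> \<nu> (\<psi> x) = \<phi> (\<nu>' x)"
  obtains h where "h \<in> carrier (dual_module R F')"
    "nu_tilde R \<alpha> \<mu>t' G' \<nu>' =
      dual_map G' \<psi> (nu_tilde R \<alpha> \<mu>t G \<nu>) \<oplus>\<^bsub>dual_module R G'\<^esub> dual_map G' \<nu>' h"
proof -
  have mods: "module R G" "module R F" "module R G'" "module R F'" "module R Q" "module R M"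
    and homs: "\<nu> \<in> mod_hom R G F" "\<mu> \<in> mod_hom R F Q" "\<nu>' \<in> mod_hom R G' F'" "\<mu>' \<in> mod_hom R F' Q"
      "\<mu>t \<in> mod_hom R F M" "\<mu>t' \<in> mod_hom R F' M"
      "\<alpha> \<in> mod_hom R (regular_module R) M" "\<beta> \<in> mod_hom R M Q"
    and exact: "\<nu> ` carrier G = a_kernel F Q \<mu>" "\<nu>' ` carrier G' = a_kernel F' Q \<mu>'"
    and inj: "inj_on \<alpha> (carrier R)"
    and lifts: "\<And>x. x \<in> carrier F \<Longrightarrow> \<beta> (\<mu>t x) = \<mu> x" "\<And>x. x \<in> carrier F' \<Longrightarrow> \<beta> (\<mu>t' x) = \<mu>' x"
    using pres se lift
    by (auto simp: free_presentation_def free_module_def short_exact_def lift_along_def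
        regular_module_simps)
  interpret G': module R G' by fact
  interpret M: module R M by fact
  interpret Q: module R Q by fact
  interpret \<beta>: abelian_group_hom M Q \<beta>
    by (rule mod_hom_abelian_group_hom) fact+
  let ?i = "inv_into (carrier R) \<alpha>"
  note closed = homs[THEN mod_hom_closed, unfolded regular_module_simps]
    \<phi>(1)[THEN mod_hom_closed] \<psi>(1)[THEN mod_hom_closed]
  have \<nu>0: "\<mu> (\<nu> x) = \<zero>\<^bsub>Q\<^esub>" if "x \<in> carrier G" for x
    using exact(1) that by (auto simp: a_kernel_def')
  have \<nu>0': "\<mu>' (\<nu>' x) = \<zero>\<^bsub>Q\<^esub>" if "x \<in> carrier G'" for x
    using exact(2) that by (auto simp: a_kernel_def')
  \<comment> \<open>Both \<open>\<mu>t'\<close> and \<open>\<mu>t \<circ> \<phi>\<close> lift \<open>\<mu>'\<close>, so their difference lands in the kernel of \<open>\<beta>\<close>.\<close>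
  let ?d = "\<lambda>x. \<mu>t' x \<ominus>\<^bsub>M\<^esub> \<mu>t (\<phi> x)"
  have d: "?d \<in> mod_hom R F' M"
    by (rule mod_hom_diff[OF mods(4,6) homs(6) mod_hom_compose[OF \<phi>(1) homs(5)]])
  have \<beta>d: "\<beta> (?d x) = \<zero>\<^bsub>Q\<^esub>" if "x \<in> carrier F'" for x
    using that by (simp add: M.minus_eq closed lifts \<phi>(2) Q.r_neg)
  define h where "h = (\<lambda>x\<in>carrier F'. ?i (?d x))"
  have h: "h \<in> carrier (dual_module R F')"
    unfolding h_def by (rule short_exact_factor(1)[OF se mods(4) d \<beta>d])
  have \<alpha>h: "\<alpha> (h x) = ?d x" if "x \<in> carrier F'" for x
    using short_exact_factor(2)[OF se mods(4) d \<beta>d that] that by (simp add: h_def)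
  note fac = short_exact_factor[OF se mods(1) mod_hom_compose[OF homs(1,5)]]
  note fac' = short_exact_factor[OF se mods(3) mod_hom_compose[OF homs(3,6)]]
  have nt: "nu_tilde R \<alpha> \<mu>t G \<nu> \<in> carrier (dual_module R G)"
    "\<And>x. x \<in> carrier G \<Longrightarrow> \<alpha> (nu_tilde R \<alpha> \<mu>t G \<nu> x) = \<mu>t (\<nu> x)"
    using fac by (auto simp: nu_tilde_def lifts closed \<nu>0)
  have nt': "nu_tilde R \<alpha> \<mu>t' G' \<nu>' \<in> carrier (dual_module R G')"
    "\<And>x. x \<in> carrier G' \<Longrightarrow> \<alpha> (nu_tilde R \<alpha> \<mu>t' G' \<nu>' x) = \<mu>t' (\<nu>' x)"
    using fac' by (auto simp: nu_tilde_def lifts closed \<nu>0')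
  have "nu_tilde R \<alpha> \<mu>t' G' \<nu>' x = nu_tilde R \<alpha> \<mu>t G \<nu> (\<psi> x) \<oplus>\<^bsub>R\<^esub> h (\<nu>' x)"
    if x: "x \<in> carrier G'" for x
  proof (rule inj_onD[OF inj])
    have "\<alpha> (nu_tilde R \<alpha> \<mu>t G \<nu> (\<psi> x) \<oplus>\<^bsub>R\<^esub> h (\<nu>' x)) = \<mu>t (\<phi> (\<nu>' x)) \<oplus>\<^bsub>M\<^esub> ?d (\<nu>' x)"
      using x by (simp add: mod_hom_add[OF homs(7), unfolded regular_module_simps]
          dual_closed[OF nt(1)] dual_closed[OF h] closed nt(2) \<alpha>h \<psi>(2))
    also have "\<dots> = \<mu>t' (\<nu>' x)"
    proof -
      have *: "a \<oplus>\<^bsub>M\<^esub> (b \<ominus>\<^bsub>M\<^esub> a) = b" if "a \<in> carrier M" "b \<in> carrier M" for a b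
        using that by (metis M.a_comm M.a_lcomm M.a_inv_closed M.minus_eq M.r_neg M.r_zero)
      show ?thesis
        using x by (intro *) (simp_all add: closed)
    qed
    finally show "\<alpha> (nu_tilde R \<alpha> \<mu>t' G' \<nu>' x) =
        \<alpha> (nu_tilde R \<alpha> \<mu>t G \<nu> (\<psi> x) \<oplus>\<^bsub>R\<^esub> h (\<nu>' x))"
      using nt'(2)[OF x] by simp
  qed (use x in \<open>auto simp: dual_closed[OF nt(1)] dual_closed[OF nt'(1)] dual_closed[OF h] closed\<close>)
  then have "nu_tilde R \<alpha> \<mu>t' G' \<nu>' =
      dual_map G' \<psi> (nu_tilde R \<alpha> \<mu>t G \<nu>) \<oplus>\<^bsub>dual_module R G'\<^esub> dual_map G' \<nu>' h"
    by (intro extensionalityI[where A = "carrier G'"] dual_extensional[OF nt'(1)])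
      (auto simp: dual_module_simps(2-) dual_map_def compose_def)
  with h show thesis
    by (rule that)
qed

text \<open>A commuting square dualizes to \<open>\<psi>\<^sup>\<or> \<circ> \<nu>\<^sup>\<or> = \<nu>'\<^sup>\<or> \<circ> \<phi>\<^sup>\<or>\<close>.\<close>

lemma dual_map_image_subset:
  assumes \<phi>: "\<phi> \<in> mod_hom R F' F" and F': "module R F'"
    and \<psi>: "\<psi> \<in> carrier G' \<rightarrow> carrier G" and \<nu>': "\<nu>' \<in> carrier G' \<rightarrow> carrier F'"
    and comm: "\<And>x. x \<in> carrier G' \<Longrightarrow> \<nu> (\<psi> x) = \<phi> (\<nu>' x)"
  shows "dual_map G' \<psi> ` dual_map G \<nu> ` carrier (dual_module R F)
    \<subseteq> dual_map G' \<nu>' ` carrier (dual_module R F')"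
proof clarify
  fix h assume h: "h \<in> carrier (dual_module R F)"
  have "dual_map G' \<psi> (dual_map G \<nu> h) = dual_map G' \<nu>' (dual_map F' \<phi> h)"
    using \<psi> \<nu>' by (auto simp: dual_map_def compose_def comm fun_eq_iff)
  moreover have "dual_map F' \<phi> h \<in> carrier (dual_module R F')"
    by (rule mod_hom_closed[OF dual_map_mod_hom[OF F' \<phi>] h])
  ultimately show "dual_map G' \<psi> (dual_map G \<nu> h) \<in> dual_map G' \<nu>' ` carrier (dual_module R F')"
    by auto
qed

theorem lemma2p5:
  fixes R :: "('a, 'r) ring_scheme" and \<mm> :: "'a set"
    and cl :: "('a, 'g \<Rightarrow> 'a) module \<Rightarrow> ('g \<Rightarrow> 'a) set \<Rightarrow> ('g \<Rightarrow> 'a) set"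
    and M :: "('a, 'm) module" and Q :: "('a, 'q) module"
    and \<alpha> :: "'a \<Rightarrow> 'm" and \<beta> :: "'m \<Rightarrow> 'q"
    and G :: "('a, 'g) module" and F :: "('a, 'f) module"
    and \<nu> :: "'g \<Rightarrow> 'f" and \<mu> :: "'f \<Rightarrow> 'q" and \<mu>t :: "'f \<Rightarrow> 'm"
    and G' :: "('a, 'g) module" and F' :: "('a, 'f2) module"
    and \<nu>' :: "'g \<Rightarrow> 'f2" and \<mu>' :: "'f2 \<Rightarrow> 'q" and \<mu>t' :: "'f2 \<Rightarrow> 'm"
  assumes "local_domain R \<mm>"
    and "big_axioms R \<mm> cl"
    and "short_exact R (regular_module R) \<alpha> M \<beta> Q"
    and "free_presentation R G \<nu> F \<mu> Q"
    and "lift_along R F \<mu> M \<beta> \<mu>t"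
    and "nu_tilde R \<alpha> \<mu>t G \<nu>
           \<in> cl (dual_module R G) (dual_map G \<nu> ` carrier (dual_module R F))"
    and "free_presentation R G' \<nu>' F' \<mu>' Q"
    and "lift_along R F' \<mu>' M \<beta> \<mu>t'"
  shows "nu_tilde R \<alpha> \<mu>t' G' \<nu>'
           \<in> cl (dual_module R G') (dual_map G' \<nu>' ` carrier (dual_module R F'))"
proof -
  interpret big_axioms R \<mm> cl by fact
  obtain \<phi> \<psi> where \<phi>: "\<phi> \<in> mod_hom R F' F" "\<And>x. x \<in> carrier F' \<Longrightarrow> \<mu> (\<phi> x) = \<mu>' x"
    and \<psi>: "\<psi> \<in> mod_hom R G' G" "\<And>x. x \<in> carrier G' \<Longrightarrow> \<nu> (\<psi> x) = \<phi> (\<nu>' x)"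
    using presentation_comparison[OF assms(4,7)] by metis
  obtain h where h: "h \<in> carrier (dual_module R F')"
    and decomp: "nu_tilde R \<alpha> \<mu>t' G' \<nu>' =
      dual_map G' \<psi> (nu_tilde R \<alpha> \<mu>t G \<nu>) \<oplus>\<^bsub>dual_module R G'\<^esub> dual_map G' \<nu>' h"
    using nu_tilde_comparison[OF assms(3,4,7,5,8) \<phi> \<psi>] by metis
  have mods: "module R G" "module R F" "module R G'" "module R F'"
    and homs: "\<nu> \<in> mod_hom R G F" "\<nu>' \<in> mod_hom R G' F'"
    using assms(4,7) by (auto simp: free_presentation_def free_module_def)
  let ?I = "dual_map G \<nu> ` carrier (dual_module R F)"
  let ?I' = "dual_map G' \<nu>' ` carrier (dual_module R F')"
  note dual_mods = mods[THEN dual_module_is_module]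
  interpret G'd: module R "dual_module R G'" by fact
  have I: "submodule ?I R (dual_module R G)"
    by (rule mod_hom_image_submodule[OF dual_mods(2,1) dual_map_mod_hom[OF mods(1) homs(1)]])
  have I': "submodule ?I' R (dual_module R G')"
    by (rule mod_hom_image_submodule[OF dual_mods(4,3) dual_map_mod_hom[OF mods(3) homs(2)]])
  have \<psi>d: "dual_map G' \<psi> \<in> mod_hom R (dual_module R G) (dual_module R G')"
    by (rule dual_map_mod_hom[OF mods(3) \<psi>(1)])
  have \<psi>I: "submodule (dual_map G' \<psi> ` ?I) R (dual_module R G')"
    using mod_hom_image_submodule[OF dual_mods(2,3)
        mod_hom_compose[OF dual_map_mod_hom[OF mods(1) homs(1)] \<psi>d]]
    by (simp add: image_image)
  have sub: "dual_map G' \<psi> ` ?I \<subseteq> ?I'"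
    using \<psi> homs(2) by (intro dual_map_image_subset[OF \<phi>(1) mods(4)]) (auto simp: mod_hom_def)
  have "dual_map G' \<psi> ` cl (dual_module R G) ?I \<subseteq> cl (dual_module R G') (dual_map G' \<psi> ` ?I)"
    by (rule big_functorial[OF dual_mods(1,3) \<psi>d I])
  also have "\<dots> \<subseteq> cl (dual_module R G') ?I'"
    by (rule big_mono[OF dual_mods(3) I' \<psi>I sub])
  finally have "dual_map G' \<psi> (nu_tilde R \<alpha> \<mu>t G \<nu>) \<in> cl (dual_module R G') ?I'"
    using assms(6) by blast
  moreover have "dual_map G' \<nu>' h \<in> cl (dual_module R G') ?I'"
    using big_extensive[OF dual_mods(3) I'] h by blast
  ultimately show ?thesis
    unfolding decomp
    using G'd.submoduleE(5) big_extensive[OF dual_mods(3) I'] by blast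
qed

end
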